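(* Let $L_1,\dots,L_m\in\mathcal{L}_*$ and let $Q \in O(p,q)$. If $\tilde{L}_i = Q L_i Q^T$, $i=1,2,\dots,m$, and if $Q$ is sufficiently close to the identity matrix, then \[ \mathcal{I}\tilde{L}(x) = Q \, \mathcal{I}L(x) \, Q^T \] for every $x \in \Omega$.
   Context: Let $n$ be a positive integer and $p,q\ge 0$ integers with $p+q=n$. Let $J=\mathrm{diag}(-1,\dots,-1,1,\dots,1)\in\mathbb{R}^{n\times n}$ with $p$ entries $-1$ and $q$ entries $1$. Let $O(p,q)=\{Q\in GL_n(\mathbb{R})\mid QJQ^T=J\}$. Let $\mathcal{L}$ be the set of nonsingular symmetric real $n\times n$ matrices with exactly $q$ positive and $p$ negative eigenvalues, and let $\mathcal{L}_*$ be the set of $L\in\mathcal{L}$ such that $LJ$ has no negative real eigenvalues. Let $\Omega\subset\mathbb{R}^d$ be a domain with points $x^{(1)},\dots,x^{(m)}\in\Omega$ and let $\phi_i:\Omega\to\mathbb{R}$, $i=1,\dots,m$, be functions satisfying $\phi_i(x^{(j)})=\delta_{ij}$. For matrices $L_1,\dots,L_m\in\mathcal{L}_*$ define the interpolant \[ \mathcal{I}L(x)=\exp\left(\sum_{i=1}^m\phi_i(x)\log(L_iJ)\right)J,\qquad x\in\Omega, \] where $\exp$ is the matrix exponential and $\log$ the principal matrix logarithm. $\mathcal{I}\tilde L$ denotes the interpolant defined by the same formula with $L_i$ replaced by $\tilde L_i$. *)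

theory Defs
  imports
    "HOL-Analysis.Analysis"
    "HOL-Computational_Algebra.Computational_Algebra"
begin

(* The class multiplication on type vec is componentwise, so the overloaded power and exp are not
   the matrix ones. *)
definition matrix_power :: "'a::semiring_1^'n^'n \<Rightarrow> nat \<Rightarrow> 'a^'n^'n" where
  "matrix_power A k = ((\<lambda>B. A ** B) ^^ k) (mat 1)"

definition matrix_exp :: "real^'n^'n \<Rightarrow> real^'n^'n" where
  "matrix_exp A = (\<Sum>k. (1 / fact k) *\<^sub>R matrix_power A k)"

definition eigenvalue :: "'a::field^'n^'n \<Rightarrow> 'a \<Rightarrow> bool" where
  "eigenvalue A c \<longleftrightarrow> (\<exists>v. v \<noteq> 0 \<and> A *v v = c *s v)"

definition charpoly :: "'a::idom^'n^'n \<Rightarrow> 'a poly" where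
  "charpoly A = det (\<chi> i j. (if i = j then [:0, 1:] else 0) - [:A $ i $ j:])"

(* The principal logarithm of A is the unique logarithm of A all of whose (complex) eigenvalues
   lie in the open strip -pi < Im z < pi.  It exists and is real when A is real and has no
   eigenvalue in the closed negative real axis; for any other A the value is irrelevant. *)
definition is_principal_log :: "real^'n^'n \<Rightarrow> real^'n^'n \<Rightarrow> bool" where
  "is_principal_log A X \<longleftrightarrow>
     matrix_exp X = A \<and>
     (\<forall>z. eigenvalue (map_matrix complex_of_real X) z \<longrightarrow> - pi < Im z \<and> Im z < pi)"

definition matrix_log :: "real^'n^'n \<Rightarrow> real^'n^'n" where
  "matrix_log A = (THE X. is_principal_log A X)"

(* J = diag(-1,...,-1,1,...,1) with p entries -1, the remaining q = n - p entries being 1;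
   the linear order on the index type gives meaning to "the first p positions". *)
definition J_mat :: "nat \<Rightarrow> real^'n::{finite,linorder}^'n::{finite,linorder}" where
  "J_mat p = (\<chi> i j. if i \<noteq> j then 0 else if card {k. k < i} < p then -1 else 1)"

(* The group O(p,q); q is determined by p and the size n of the matrices, here and below. *)
definition O_group :: "nat \<Rightarrow> (real^'n::{finite,linorder}^'n::{finite,linorder}) set" where
  "O_group p = {Q. invertible Q \<and> Q ** J_mat p ** transpose Q = J_mat p}"

(* Eigenvalues are counted with multiplicity: proots is the multiset of roots. *)
definition L_set :: "nat \<Rightarrow> nat \<Rightarrow> (real^'n^'n) set" where
  "L_set p q = {L. invertible L \<and> transpose L = L \<and>
     size (filter_mset (\<lambda>c. c > 0) (proots (charpoly L))) = q \<and>
     size (filter_mset (\<lambda>c. c < 0) (proots (charpoly L))) = p}"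

definition L_star :: "nat \<Rightarrow> nat \<Rightarrow> (real^'n::{finite,linorder}^'n::{finite,linorder}) set" where
  "L_star p q = {L \<in> L_set p q. \<forall>c<0. \<not> eigenvalue (L ** J_mat p) c}"

definition interpolant ::
  "nat \<Rightarrow> nat \<Rightarrow> (nat \<Rightarrow> 'b \<Rightarrow> real) \<Rightarrow> (nat \<Rightarrow> real^'n::{finite,linorder}^'n::{finite,linorder}) \<Rightarrow> 'b
    \<Rightarrow> real^'n::{finite,linorder}^'n::{finite,linorder}" where
  "interpolant p m \<phi> L x =
     matrix_exp (\<Sum>i=1..m. \<phi> i x *\<^sub>R matrix_log (L i ** J_mat p)) ** J_mat p"

end

theory Submission
  imports Defs
begin

text \<open>For \<open>Q\<close> in O(p,q) the matrix \<open>P = J Q\<^sup>T J\<close> is the inverse of \<open>Q\<close>, so \<open>Q L Q\<^sup>T J = Q (L J) P\<close> is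
  a conjugate of \<open>L J\<close>, and the matrix exponential commutes with conjugation.  The principal
  logarithm does too, but it is defined by a definite description, so its existence and
  uniqueness have to be established for every real matrix \<open>A\<close> without eigenvalues on the
  closed negative real axis.

  Existence: with \<open>B(t) = I + t (A - I)\<close> and \<open>X(t) = \<integral>\<^bsub>0\<^esub>\<^bsup>t\<^esup> (A - I) B(s)\<^bsup>-1\<^esup> ds\<close> the matrix
  \<open>exp(-X(t)) B(t)\<close> has derivative zero, hence \<open>exp(X(1)) = A\<close>.  On a common eigenvector of \<open>A\<close> and
  \<open>X(1)\<close> the integral evaluates to the principal complex logarithm of the eigenvalue of \<open>A\<close>.

  Uniqueness: another principal logarithm \<open>Z\<close> commutes with \<open>A\<close>, hence with \<open>X = X(1)\<close>.  Then
  \<open>exp(X - Z) = I\<close>, and common eigenvectors show that \<open>0\<close> is the only eigenvalue of \<open>D = X - Z\<close>.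
  If \<open>D\<close> were nonzero there would be \<open>y\<close> with \<open>D y \<noteq> 0 = D\<^sup>2 y\<close>, whence \<open>exp(D) y = y + D y \<noteq> y\<close>.\<close>

section \<open>Matrix multiplication as a bounded bilinear map\<close>

lemma bounded_bilinear_matrix_matrix_mult:
  "bounded_bilinear ((**) :: real^'n^'m \<Rightarrow> real^'k^'n \<Rightarrow> real^'k^'m)"
  unfolding bilinear_conv_bounded_bilinear[symmetric] bilinear_def
  by (auto intro!: linearI simp: vec_eq_iff matrix_matrix_mult_def algebra_simps sum.distrib sum_distrib_left)

interpretation matrix_mult: bounded_bilinear "(**) :: real^'n^'m \<Rightarrow> real^'k^'n \<Rightarrow> real^'k^'m"
  by (rule bounded_bilinear_matrix_matrix_mult)

interpretation matrix_vector: bounded_bilinear "(*v) :: real^'n^'m \<Rightarrow> real^'n \<Rightarrow> real^'m"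
  unfolding bilinear_conv_bounded_bilinear[symmetric] bilinear_def
  by (auto intro!: linearI simp: vec_eq_iff matrix_vector_mult_def algebra_simps sum.distrib sum_distrib_left)

section \<open>The matrix exponential\<close>

lemma matrix_power_0 [simp]: "matrix_power A 0 = mat 1"
  and matrix_power_Suc: "matrix_power A (Suc k) = A ** matrix_power A k"
  by (simp_all add: matrix_power_def)

lemma matrix_power_commute:
  "A ** B = B ** A \<Longrightarrow> matrix_power A k ** B = B ** matrix_power A k"
proof (induction k)
  case (Suc k)
  have "matrix_power A (Suc k) ** B = A ** (matrix_power A k ** B)"
    by (simp add: matrix_power_Suc matrix_mul_assoc)
  also have "\<dots> = (A ** B) ** matrix_power A k"
    using Suc by (simp add: matrix_mul_assoc)
  finally show ?case
    using Suc.prems by (simp add: matrix_power_Suc matrix_mul_assoc)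
qed simp

text \<open>One constant \<open>K\<close>, the bound of the bilinear product, serves for all
  matrices, which makes later majorants uniform. The Euclidean norm of the entries of
  \<open>mat 1\<close> is in general not 1 and stays as a factor.\<close>

lemma norm_matrix_power_le:
  obtains K where "K > 0"
    "\<And>(A :: real^'n^'n) (B :: real^'n^'n). norm (A ** B) \<le> norm A * norm B * K"
    "\<And>(A :: real^'n^'n) k. norm (matrix_power A k) \<le> norm (mat 1 :: real^'n^'n) * (K * norm A) ^ k"
proof -
  obtain K where K: "K > 0" "\<And>(A :: real^'n^'n) (B :: real^'n^'n). norm (A ** B) \<le> norm A * norm B * K"
    using matrix_mult.pos_bounded by blast
  have "norm (matrix_power A k) \<le> norm (mat 1 :: real^'n^'n) * (K * norm A) ^ k" for A :: "real^'n^'n" and k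
  proof (induction k)
    case (Suc k)
    have "norm (matrix_power A (Suc k)) \<le> norm A * norm (matrix_power A k) * K"
      unfolding matrix_power_Suc by (rule K)
    also have "\<dots> \<le> norm A * (norm (mat 1 :: real^'n^'n) * (K * norm A) ^ k) * K"
      using Suc K(1) by (intro mult_right_mono mult_left_mono) auto
    finally show ?case by (simp add: mult_ac)
  qed simp
  with K that show thesis by blast
qed

lemma matrix_exp_sums: "(\<lambda>k. (1 / fact k) *\<^sub>R matrix_power A k) sums matrix_exp A"
proof -
  obtain K where K: "K > 0" "\<And>(A :: real^'a^'a) (B :: real^'a^'a). norm (A ** B) \<le> norm A * norm B * K"
    "\<And>(A :: real^'a^'a) k. norm (matrix_power A k) \<le> norm (mat 1 :: real^'a^'a) * (K * norm A) ^ k"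
    by (rule norm_matrix_power_le) (rule that)
  have "summable (\<lambda>k. norm (mat 1 :: real^'a^'a) * (inverse (fact k) * (K * norm A) ^ k))"
    by (intro summable_mult summable_exp)
  then have "summable (\<lambda>k. (1 / fact k) *\<^sub>R matrix_power A k)"
    by (rule summable_comparison_test[rotated])
      (use K(3)[of A] in \<open>auto simp: divide_simps mult_ac intro!: exI[of _ 0]\<close>)
  then show ?thesis
    unfolding matrix_exp_def by (rule summable_sums)
qed

lemma matrix_exp_commute:
  assumes "A ** B = B ** A"
  shows "matrix_exp A ** B = B ** matrix_exp A"
proof -
  have "(\<lambda>k. ((1 / fact k) *\<^sub>R matrix_power A k) ** B) sums (matrix_exp A ** B)"
    by (rule bounded_linear.sums[OF matrix_mult.bounded_linear_left matrix_exp_sums])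
  moreover have "(\<lambda>k. B ** ((1 / fact k) *\<^sub>R matrix_power A k)) sums (B ** matrix_exp A)"
    by (rule bounded_linear.sums[OF matrix_mult.bounded_linear_right matrix_exp_sums])
  ultimately show ?thesis
    by (simp add: matrix_mult.scaleR_left matrix_mult.scaleR_right matrix_power_commute[OF assms] sums_unique2)
qed

lemma matrix_exp_conj:
  assumes "P' ** P = mat 1" "P ** P' = mat 1"
  shows "matrix_exp (P ** A ** P') = P ** matrix_exp A ** P'"
proof -
  have pow: "matrix_power (P ** A ** P') k = P ** matrix_power A k ** P'" for k
  proof (induction k)
    case (Suc k)
    have "matrix_power (P ** A ** P') (Suc k) = P ** A ** (P' ** P) ** matrix_power A k ** P'"
      by (simp add: matrix_power_Suc Suc matrix_mul_assoc)
    then show ?case by (simp add: assms matrix_power_Suc matrix_mul_assoc)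
  qed (simp add: assms)
  have "(\<lambda>k. P ** ((1 / fact k) *\<^sub>R matrix_power A k) ** P') sums (P ** matrix_exp A ** P')"
    by (intro bounded_linear.sums[OF matrix_mult.bounded_linear_left] bounded_linear.sums[OF matrix_mult.bounded_linear_right] matrix_exp_sums)
  then show ?thesis
    using matrix_exp_sums[of "P ** A ** P'"]
    by (simp add: pow matrix_mult.scaleR_left matrix_mult.scaleR_right sums_unique2)
qed

lemma matrix_exp_0 [simp]: "matrix_exp (0 :: real^'n^'n) = mat 1"
proof -
  have "matrix_power (0 :: real^'n^'n) (Suc k) = 0" for k
    by (simp add: matrix_power_Suc matrix_mult.zero_left)
  then have "(\<lambda>k. (1 / fact k) *\<^sub>R matrix_power (0 :: real^'n^'n) k) = (\<lambda>k. if k = 0 then mat 1 else 0)"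
    by (auto simp: fun_eq_iff gr0_conv_Suc)
  then show ?thesis
    using matrix_exp_sums[of "0 :: real^'n^'n"] sums_single[of 0 "\<lambda>_. mat 1 :: real^'n^'n"]
    by (simp add: sums_unique2)
qed

text \<open>Commutation lets \<open>F'\<close> move to the front of each product-rule term, as in
  the scalar case. At \<open>k = 0\<close> the truncated exponent \<open>k - 1\<close> is harmless
  because of the factor \<open>of_nat k\<close>.\<close>

lemma matrix_power_has_vector_derivative:
  fixes F :: "real \<Rightarrow> real^'n^'n"
  assumes "(F has_vector_derivative F') (at t within S)" "F' ** F t = F t ** F'"
  shows "((\<lambda>s. matrix_power (F s) k) has_vector_derivative of_nat k *\<^sub>R (F' ** matrix_power (F t) (k - 1))) (at t within S)"
proof (induction k)
  case (Suc k)
  have "F t ** (F' ** matrix_power (F t) (k - 1)) = F' ** matrix_power (F t) k" if "k > 0"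
    using that assms(2) by (cases k) (simp_all add: matrix_power_Suc matrix_mul_assoc)
  then have "F t ** (of_nat k *\<^sub>R (F' ** matrix_power (F t) (k - 1))) + F' ** matrix_power (F t) k
      = of_nat (Suc k) *\<^sub>R (F' ** matrix_power (F t) k)"
    by (cases "k = 0") (auto simp: matrix_mult.scaleR_right scaleR_left_distrib)
  then show ?case
    using matrix_mult.has_vector_derivative[OF assms(1) Suc] by (simp add: matrix_power_Suc)
qed simp

text \<open>Termwise differentiation of the exponential series: bounds for \<open>F\<close> and
  \<open>F'\<close> on \<open>S\<close> give an M-test for the derivative series, and convexity of
  \<open>S\<close> serves the theorem on differentiating series.\<close>

lemma matrix_exp_has_vector_derivative:
  fixes F :: "real \<Rightarrow> real^'n^'n"
  assumes S: "convex S" "t \<in> S" "bounded (F ` S)" "bounded (F' ` S)"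
    and F: "\<And>s. s \<in> S \<Longrightarrow> (F has_vector_derivative F' s) (at s within S)"
    and comm: "\<And>s. s \<in> S \<Longrightarrow> F' s ** F s = F s ** F' s"
  shows "((\<lambda>s. matrix_exp (F s)) has_vector_derivative F' t ** matrix_exp (F t)) (at t within S)"
proof -
  define f where "f k s = (1 / fact k) *\<^sub>R matrix_power (F s) k" for k s
  define f' where "f' k s = (1 / fact k) *\<^sub>R of_nat k *\<^sub>R (F' s ** matrix_power (F s) (k - 1))" for k s
  have der: "(f k has_vector_derivative f' k s) (at s within S)" if "s \<in> S" for k s
    unfolding f_def f'_def
    by (intro bounded_linear.has_vector_derivative[OF bounded_linear_scaleR_right]
        matrix_power_has_vector_derivative F comm that)
  have f'_sums: "(\<lambda>k. f' k s) sums (F' s ** matrix_exp (F s))" for s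
  proof -
    \<comment> \<open>Index shift: the factor \<open>Suc k\<close> cancels into the factorial and
      the zeroth term vanishes, leaving \<open>F' s\<close> times the exponential series.\<close>
    have "f' (Suc k) s = F' s ** ((1 / fact k) *\<^sub>R matrix_power (F s) k)" for k
      by (simp add: f'_def matrix_mult.scaleR_right divide_simps del: of_nat_Suc)
    moreover have "(\<lambda>k. F' s ** ((1 / fact k) *\<^sub>R matrix_power (F s) k)) sums (F' s ** matrix_exp (F s))"
      by (rule bounded_linear.sums[OF matrix_mult.bounded_linear_right matrix_exp_sums])
    ultimately have "(\<lambda>k. f' (Suc k) s) sums (F' s ** matrix_exp (F s))" by simp
    moreover have "f' 0 s = 0" by (simp add: f'_def)
    ultimately show ?thesis using sums_Suc[of "\<lambda>k. f' k s"] by simp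
  qed
  obtain K where K: "K > 0" "\<And>(A :: real^'n^'n) (B :: real^'n^'n). norm (A ** B) \<le> norm A * norm B * K"
    "\<And>(A :: real^'n^'n) k. norm (matrix_power A k) \<le> norm (mat 1 :: real^'n^'n) * (K * norm A) ^ k"
    by (rule norm_matrix_power_le) (rule that)
  obtain R where R: "R > 0" "\<And>s. s \<in> S \<Longrightarrow> norm (F s) \<le> R"
    using S(3) by (auto simp: bounded_pos)
  obtain R' where R': "R' > 0" "\<And>s. s \<in> S \<Longrightarrow> norm (F' s) \<le> R'"
    using S(4) by (auto simp: bounded_pos)
  define N where "N = norm (mat 1 :: real^'n^'n)"
  \<comment> \<open>Majorant of \<open>f'\<close>, with the same shift by one.\<close>
  define M where "M k = (if k = 0 then 0 else R' * (N * (K * R) ^ (k - 1)) * K / fact (k - 1))" for k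
  have "summable (\<lambda>k. R' * N * K * (inverse (fact k) * (K * R) ^ k))"
    by (intro summable_mult summable_exp)
  then have "summable (\<lambda>k. M (Suc k))"
    by (simp add: M_def field_simps)
  then have "summable M" by (simp only: summable_Suc_iff)
  have bound: "norm (f' k s) \<le> M k" if "s \<in> S" for k s
  proof (cases k)
    case (Suc j)
    have "norm (F' s ** matrix_power (F s) j) \<le> norm (F' s) * norm (matrix_power (F s) j) * K"
      by (rule K)
    also have "\<dots> \<le> R' * (N * (K * R) ^ j) * K"
    proof (intro mult_right_mono mult_mono)
      have "norm (matrix_power (F s) j) \<le> N * (K * norm (F s)) ^ j"
        using K(3) by (simp add: N_def)
      also have "\<dots> \<le> N * (K * R) ^ j"
        using K(1) R that by (intro mult_left_mono power_mono) (auto simp: N_def)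
      finally show "norm (matrix_power (F s) j) \<le> N * (K * R) ^ j" .
    qed (use R' K(1) that in auto)
    finally show ?thesis
      by (simp add: Suc f'_def M_def divide_right_mono del: of_nat_Suc)
  qed (simp add: f'_def M_def)
  have lim: "uniform_limit S (\<lambda>n s. \<Sum>k<n. f' k s) (\<lambda>s. F' s ** matrix_exp (F s)) sequentially"
    using Weierstrass_m_test[OF bound \<open>summable M\<close>] sums_unique[OF f'_sums] by simp
  have "\<exists>g. \<forall>s\<in>S. (\<lambda>k. f k s) sums g s \<and>
      (g has_derivative (\<lambda>h. h *\<^sub>R (F' s ** matrix_exp (F s)))) (at s within S)"
  proof (rule has_derivative_series[OF S(1) _ _ S(2)])
    show "(f k has_derivative (\<lambda>h. h *\<^sub>R f' k s)) (at s within S)" if "s \<in> S" for k s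
      using der[OF that] by (simp add: has_vector_derivative_def)
    show "(\<lambda>k. f k t) sums matrix_exp (F t)"
      unfolding f_def by (rule matrix_exp_sums)
    fix e :: real assume "e > 0"
    then have "\<forall>\<^sub>F n in sequentially. \<forall>s\<in>S. norm ((\<Sum>k<n. f' k s) - F' s ** matrix_exp (F s)) < e"
      using lim by (simp add: uniform_limit_iff dist_norm)
    then show "\<forall>\<^sub>F n in sequentially. \<forall>s\<in>S. \<forall>h.
        norm ((\<Sum>k<n. h *\<^sub>R f' k s) - h *\<^sub>R (F' s ** matrix_exp (F s))) \<le> e * norm h"
      by eventually_elim
        (auto simp: scaleR_sum_right[symmetric] scaleR_diff_right[symmetric] mult.commute[of e]
          intro!: mult_left_mono intro: less_imp_le simp del: mult_le_cancel_left)
  qed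
  then obtain g where g: "\<And>s. s \<in> S \<Longrightarrow> (\<lambda>k. f k s) sums g s"
    "\<And>s. s \<in> S \<Longrightarrow> (g has_vector_derivative F' s ** matrix_exp (F s)) (at s within S)"
    by (auto simp: has_vector_derivative_def)
  \<comment> \<open>The series theorem yields only some sum \<open>g\<close>; uniqueness of sums
    identifies it.\<close>
  have "g s = matrix_exp (F s)" if "s \<in> S" for s
    using sums_unique2[OF g(1)[OF that]] matrix_exp_sums[of "F s"] by (simp add: f_def)
  then show ?thesis
    using has_vector_derivative_transform[OF S(2) _ g(2)[OF S(2)]] by simp
qed

text \<open>The same product with \<open>A\<close> and \<open>B\<close> scaled by \<open>s\<close>
  has derivative zero on the unit interval and is \<open>mat 1\<close> at \<open>s = 0\<close>. This
  form supplies both inverses (\<open>B = 0\<close>) and the law for sums of commuting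
  matrices.\<close>

lemma matrix_exp_add_cancel:
  fixes A B :: "real^'n^'n"
  assumes comm: "A ** B = B ** A"
  shows "matrix_exp (- (A + B)) ** (matrix_exp A ** matrix_exp B) = mat 1"
proof -
  have d: "((\<lambda>s. matrix_exp (s *\<^sub>R C)) has_vector_derivative C ** matrix_exp (t *\<^sub>R C)) (at t within {0..1})"
    if "t \<in> {0..1}" for C :: "real^'n^'n" and t
  proof (rule matrix_exp_has_vector_derivative)
    show "((\<lambda>s. s *\<^sub>R C) has_vector_derivative C) (at s within {0..1})" for s
      by (auto intro!: derivative_eq_intros)
    show "bounded ((\<lambda>s. s *\<^sub>R C) ` {0..1::real})"
      by (intro compact_imp_bounded compact_continuous_image continuous_intros) auto
  qed (use that in \<open>auto simp: matrix_mult.scaleR_left matrix_mult.scaleR_right image_constant_conv\<close>)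
  define G where "G s = matrix_exp (s *\<^sub>R (- (A + B))) ** (matrix_exp (s *\<^sub>R A) ** matrix_exp (s *\<^sub>R B))" for s
  have "(G has_vector_derivative 0) (at t within {0..1})" if "t \<in> {0..1}" for t
  proof -
    let ?E = "matrix_exp (t *\<^sub>R (- (A + B)))" and ?EA = "matrix_exp (t *\<^sub>R A)" and ?EB = "matrix_exp (t *\<^sub>R B)"
    have EA: "?E ** A = A ** ?E" "?E ** B = B ** ?E" "?EA ** B = B ** ?EA"
      by (rule matrix_exp_commute; simp add: algebra_simps comm
          matrix_mult.scaleR_left matrix_mult.scaleR_right matrix_mult.add_left matrix_mult.add_right
          matrix_mult.minus_left matrix_mult.minus_right matrix_mult.diff_left matrix_mult.diff_right)+
    \<comment> \<open>Commutation pulls \<open>B\<close>, and below \<open>A\<close>, to the front,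
      where the product-rule terms cancel against the one from \<open>- (A + B)\<close>.\<close>
    have "?E ** (?EA ** (B ** ?EB)) = ?E ** ((?EA ** B) ** ?EB)"
      by (simp add: matrix_mul_assoc)
    also have "\<dots> = (?E ** B) ** (?EA ** ?EB)"
      unfolding EA(3) by (simp add: matrix_mul_assoc)
    finally have B: "?E ** (?EA ** (B ** ?EB)) = B ** (?E ** (?EA ** ?EB))"
      unfolding EA(2) by (simp add: matrix_mul_assoc)
    have "?E ** (A ** ?EA ** ?EB) = (?E ** A) ** (?EA ** ?EB)"
      by (simp add: matrix_mul_assoc)
    then have A: "?E ** (A ** ?EA ** ?EB) = A ** (?E ** (?EA ** ?EB))"
      unfolding EA(1) by (simp add: matrix_mul_assoc)
    have "?E ** (?EA ** (B ** ?EB) + A ** ?EA ** ?EB) + - (A + B) ** ?E ** (?EA ** ?EB) = 0"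
      unfolding matrix_mult.add_right A B by (simp add: matrix_mult.add_left matrix_mult.minus_left matrix_mult.diff_left matrix_mul_assoc)
    then show ?thesis
      using matrix_mult.has_vector_derivative[OF d[OF that, of "- (A + B)"]
          matrix_mult.has_vector_derivative[OF d[OF that, of A] d[OF that, of B]]]
      unfolding G_def by simp
  qed
  then obtain c where "\<And>s. s \<in> {0..1} \<Longrightarrow> G s = c"
    using has_vector_derivative_zero_constant[of "{0..1}" G] by auto
  then have "G 1 = G 0" by simp
  then show ?thesis by (simp add: G_def)
qed

section \<open>Eigenvectors in invariant subspaces\<close>

text \<open>The vector r(A) w, evaluated by Horner's rule with matrix-vector products only.\<close>

definition krylov :: "'a::field^'n^'n \<Rightarrow> 'a^'n \<Rightarrow> 'a poly \<Rightarrow> 'a^'n" where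
  "krylov A w r = fold_coeffs (\<lambda>a u. a *s w + A *v u) r 0"

lemma krylov_0 [simp]: "krylov A w 0 = 0"
  by (simp add: krylov_def)

lemma krylov_pCons [simp]: "krylov A w (pCons a r) = a *s w + A *v krylov A w r"
  by (cases "a = 0 \<and> r = 0") (auto simp: krylov_def)

lemma krylov_add: "krylov A w (r + s) = krylov A w r + krylov A w s"
proof (induction r s rule: poly_induct2)
  case (pCons a r b s)
  then show ?case by (simp add: algebra_simps vec.scale_left_distrib)
qed simp

lemma krylov_smult: "krylov A w (smult c r) = c *s krylov A w r"
  by (induction r)
    (simp_all add: vector_smult_assoc vector_add_ldistrib vec.scale)

lemma krylov_sum: "krylov A w (sum r I) = (\<Sum>i\<in>I. krylov A w (r i))"
  by (induction I rule: infinite_finite_induct) (simp_all add: krylov_add)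

lemma krylov_in_subspace:
  assumes "vec.subspace W" "\<And>v. v \<in> W \<Longrightarrow> A *v v \<in> W" "w \<in> W"
  shows "krylov A w r \<in> W"
  using assms by (induction r) (auto simp: vec.subspace_0 vec.subspace_add vec.subspace_scale)

text \<open>The n + 1 vectors A^i w with i \<le> n lie in a space of dimension n; a nontrivial
  linear relation between them is the polynomial \<open>r\<close>.\<close>

lemma krylov_annihilator:
  fixes A :: "'a::field^'n^'n"
  shows "\<exists>r\<noteq>0. krylov A w r = 0"
proof -
  let ?f = "\<lambda>i. krylov A w (monom 1 i)"
  let ?I = "{..CARD('n)}"
  \<comment> \<open>Dependence concerns the set of vectors, so coinciding powers are treated apart:
    there x^i - x^j annihilates \<open>w\<close>.\<close>
  show ?thesis
  proof (cases "inj_on ?f ?I")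
    case True
    then have "card (?f ` ?I) > CARD('n)" by (simp add: card_image)
    then have "vec.dependent (?f ` ?I)"
      using vec.independent_card_le_dim[of "?f ` ?I" UNIV] by (auto simp: card_cart_basis)
    then obtain u where u: "\<exists>v\<in>?f ` ?I. u v \<noteq> 0" "(\<Sum>v\<in>?f ` ?I. u v *s v) = 0"
      by (auto simp: vec.dependent_finite)
    define r where "r = (\<Sum>i\<in>?I. smult (u (?f i)) (monom 1 i))"
    obtain k where k: "k \<le> CARD('n)" "u (?f k) \<noteq> 0" using u(1) by auto
    have "coeff r k = (\<Sum>i\<in>?I. if i = k then u (?f k) else 0)"
      unfolding r_def coeff_sum by (intro sum.cong) auto
    then have "coeff r k \<noteq> 0" using k by simp
    then have "r \<noteq> 0" by auto
    moreover have "krylov A w r = 0"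
      using u(2) True by (simp add: r_def krylov_sum krylov_smult sum.reindex)
    ultimately show ?thesis by blast
  next
    case False
    then obtain i j where ij: "i \<noteq> j" "?f i = ?f j" by (auto simp: inj_on_def)
    have "coeff (monom 1 i + smult (- 1) (monom 1 j)) i = (1 :: 'a)"
      using ij by simp
    then have "monom 1 i + smult (- 1) (monom 1 j) \<noteq> (0 :: 'a poly)"
      by (metis coeff_0 zero_neq_one)
    moreover have "krylov A w (monom 1 i + smult (- 1) (monom 1 j)) = 0"
      using ij by (simp only: krylov_add krylov_smult) simp
    ultimately show ?thesis by blast
  qed
qed

text \<open>If \<open>(x - a) s\<close> annihilates \<open>w\<close> and has minimal degree, then \<open>s(A) w\<close> is an eigenvector for \<open>a\<close>.\<close>

lemma invariant_subspace_eigenvector: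
  fixes A :: "complex^'n^'n"
  assumes W: "vec.subspace W" "\<And>v. v \<in> W \<Longrightarrow> A *v v \<in> W" and w: "w \<in> W" "w \<noteq> 0"
  obtains v c where "v \<in> W" "v \<noteq> 0" "A *v v = c *s v"
proof -
  define d where "d = (LEAST d. \<exists>r. r \<noteq> 0 \<and> krylov A w r = 0 \<and> degree r = d)"
  have "\<exists>d r. r \<noteq> 0 \<and> krylov A w r = 0 \<and> degree r = d"
    using krylov_annihilator[of A w] by blast
  from LeastI_ex[OF this] obtain r where r: "r \<noteq> 0" "krylov A w r = 0" "degree r = d"
    unfolding d_def by blast
  have min: "krylov A w s \<noteq> 0" if "s \<noteq> 0" "degree s < d" for s
    using that not_less_Least[of "degree s"] unfolding d_def by blast
  have "degree r \<noteq> 0"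
  proof
    assume "degree r = 0"
    then obtain a where "r = [:a:]" by (auto elim: degree_eq_zeroE)
    with r w show False by auto
  qed
  then have "\<not> constant (poly r)" by (simp add: constant_degree)
  then obtain a where "poly r a = 0" using fundamental_theorem_of_algebra by blast
  then obtain s where s: "r = [:- a, 1:] * s" by (auto simp: poly_eq_0_iff_dvd)
  have "s \<noteq> 0" using r s by auto
  moreover have "degree s < d"
    using r(3) \<open>s \<noteq> 0\<close> unfolding s by (subst (asm) degree_mult_eq) auto
  ultimately have "krylov A w s \<noteq> 0" by (rule min)
  moreover have "A *v krylov A w s = a *s krylov A w s"
  proof -
    have "r = pCons 0 s + smult (- a) s" by (simp add: s)
    then have "A *v krylov A w s + (- a) *s krylov A w s = 0"
      using r(2) by (simp only: krylov_add krylov_smult krylov_pCons) simp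
    then show ?thesis by (simp add: add_eq_0_iff vector_smult_lneg)
  qed
  ultimately show thesis
    using that krylov_in_subspace[OF W w(1)] by blast
qed

section \<open>Complexification of real matrices\<close>

abbreviation cmat :: "real^'n^'m \<Rightarrow> complex^'n^'m" where
  "cmat \<equiv> map_matrix complex_of_real"

lemma cmat_mult: "cmat (A ** B) = cmat A ** cmat B"
  by (simp add: vec_eq_iff matrix_matrix_mult_def)

lemma cmat_mat_1: "cmat (mat 1) = mat 1"
  by (simp add: vec_eq_iff mat_def)

lemma bounded_linear_cmat_mult_vec: "bounded_linear (\<lambda>A :: real^'n^'m. cmat A *v v)"
  unfolding linear_conv_bounded_linear[symmetric]
  by (rule linearI)
    (simp_all add: vec_eq_iff matrix_vector_mult_def algebra_simps sum.distrib sum_distrib_left scaleR_conv_of_real[where 'a = complex])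

lemma cmat_add_mult_vec: "cmat (A + B) *v v = cmat A *v v + cmat B *v v"
  and cmat_diff_mult_vec: "cmat (A - B) *v v = cmat A *v v - cmat B *v v"
  and cmat_scaleR_mult_vec: "cmat (c *\<^sub>R A) *v v = complex_of_real c *s (cmat A *v v)"
  by (simp_all add: linear_add[OF bounded_linear.linear[OF bounded_linear_cmat_mult_vec]]
      linear_diff[OF bounded_linear.linear[OF bounded_linear_cmat_mult_vec]]
      linear_cmul[OF bounded_linear.linear[OF bounded_linear_cmat_mult_vec]])
    (simp add: vec_eq_iff scaleR_conv_of_real[where 'a = complex])

lemma cmat_mult_vec_nth:
  "Re ((cmat A *v v) $ i) = (A *v (\<chi> j. Re (v $ j))) $ i"
  "Im ((cmat A *v v) $ i) = (A *v (\<chi> j. Im (v $ j))) $ i"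
  by (simp_all add: matrix_vector_mult_def)

lemma cmat_mult_vec_eq_0_iff:
  "cmat A *v v = 0 \<longleftrightarrow> A *v (\<chi> j. Re (v $ j)) = 0 \<and> A *v (\<chi> j. Im (v $ j)) = 0"
  by (auto simp: vec_eq_iff complex_eq_iff cmat_mult_vec_nth)

text \<open>Real and imaginary parts of the complex eigenvector both satisfy the real eigenvalue
  equation, and one of them is nonzero.\<close>

lemma eigenvalue_cmat_of_real: "eigenvalue (cmat A) (complex_of_real c) \<Longrightarrow> eigenvalue A c"
proof -
  assume "eigenvalue (cmat A) (complex_of_real c)"
  then obtain v where v: "v \<noteq> 0" "cmat A *v v = complex_of_real c *s v"
    by (auto simp: eigenvalue_def)
  have "A *v (\<chi> j. Re (v $ j)) = c *s (\<chi> j. Re (v $ j))"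
    "A *v (\<chi> j. Im (v $ j)) = c *s (\<chi> j. Im (v $ j))"
    by (simp_all add: vec_eq_iff cmat_mult_vec_nth[symmetric] v(2))
  moreover have "(\<chi> j. Re (v $ j)) \<noteq> 0 \<or> (\<chi> j. Im (v $ j)) \<noteq> 0"
    using v(1) by (auto simp: vec_eq_iff complex_eq_iff)
  ultimately show ?thesis by (auto simp: eigenvalue_def)
qed

lemma cmat_exp_eigenvector:
  assumes v: "cmat A *v v = z *s v"
  shows "cmat (matrix_exp A) *v v = exp z *s v"
proof -
  have pow: "cmat (matrix_power A k) *v v = z ^ k *s v" for k
    by (induction k)
      (simp_all add: cmat_mat_1 matrix_power_Suc cmat_mult matrix_vector_mul_assoc[symmetric]
        vec.scale v vector_smult_assoc mult.commute)
  have "(\<lambda>k. cmat ((1 / fact k) *\<^sub>R matrix_power A k) *v v) sums (cmat (matrix_exp A) *v v)"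
    by (rule bounded_linear.sums[OF bounded_linear_cmat_mult_vec matrix_exp_sums])
  moreover have "cmat ((1 / fact k) *\<^sub>R matrix_power A k) *v v = (z ^ k /\<^sub>R fact k) *s v" for k
    by (simp add: cmat_scaleR_mult_vec pow vector_smult_assoc scaleR_conv_of_real[where 'a = complex] divide_simps)
  moreover have "(\<lambda>k. (z ^ k /\<^sub>R fact k) *s v) sums (exp z *s v)"
  proof -
    have "bounded_linear (\<lambda>c. c *s v)"
      unfolding linear_conv_bounded_linear[symmetric]
      by (rule linearI) (simp_all add: vec_eq_iff algebra_simps)
    from bounded_linear.sums[OF this exp_converges] show ?thesis .
  qed
  ultimately show ?thesis by (simp add: sums_unique2)
qed

text \<open>The eigenspace of \<open>cmat A\<close> for \<open>z\<close> is invariant under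
  \<open>cmat B\<close>, hence contains an eigenvector of it.\<close>

lemma commuting_eigenvector:
  assumes "A ** B = B ** A" "eigenvalue (cmat A) z"
  obtains v c where "v \<noteq> 0" "cmat A *v v = z *s v" "cmat B *v v = c *s v"
proof -
  let ?W = "{v. cmat A *v v = z *s v}"
  obtain w where w: "w \<noteq> 0" "cmat A *v w = z *s w"
    using assms(2) by (auto simp: eigenvalue_def)
  have "vec.subspace ?W"
    by (auto simp: vec.subspace_def matrix_vector_right_distrib vector_add_ldistrib vec.scale
        vector_smult_assoc mult.commute)
  moreover have "cmat B *v v \<in> ?W" if "v \<in> ?W" for v
  proof -
    have "cmat A *v (cmat B *v v) = cmat B *v (cmat A *v v)"
      by (simp add: matrix_vector_mul_assoc flip: cmat_mult) (simp add: assms)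
    then show ?thesis using that by (simp add: vec.scale)
  qed
  ultimately show thesis
    using invariant_subspace_eigenvector[of ?W "cmat B" w] w that by blast
qed

section \<open>The principal logarithm\<close>

text \<open>By Cramer's rule the entries of \<open>C s\<close> are quotients of determinants in the
  entries of \<open>B s\<close>. This applies to inverses obtained pointwise by choice.\<close>

lemma continuous_on_right_inverse:
  fixes B C :: "'a::topological_space \<Rightarrow> real^'n^'n"
  assumes B: "continuous_on S B" and inv: "\<And>s. s \<in> S \<Longrightarrow> B s ** C s = mat 1"
  shows "continuous_on S C"
proof -
  have det: "det (B s) \<noteq> 0" if "s \<in> S" for s
    using inv[OF that] by (metis det_I det_mul mult_zero_left zero_neq_one)
  \<comment> \<open>\<open>B s\<close> with column \<open>k\<close> replaced by the
    \<open>j\<close>-th basis vector.\<close>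
  define D where "D s k j = (\<chi> i l. if l = k then axis j 1 $ i else B s $ i $ l :: real^'n^'n)" for s k j
  have "C s $ k $ j = det (D s k j) / det (B s)" if "s \<in> S" for s k j
  proof -
    have "B s *v (C s *v axis j 1) = axis j 1"
      by (simp add: matrix_vector_mul_assoc inv[OF that])
    then have "(C s *v axis j 1) $ k = det (D s k j) / det (B s)"
      unfolding cramer[OF det[OF that]] D_def by simp
    then show ?thesis by (simp add: matrix_vector_mult_basis column_def)
  qed
  then have "C s = (\<chi> k j. det (D s k j) / det (B s))" if "s \<in> S" for s
    using that by (simp add: vec_eq_iff)
  moreover have comp: "continuous_on S (\<lambda>s. B s $ i $ j)" for i j
    by (intro continuous_on_component B)
  have "continuous_on S (\<lambda>s. det (B s))"
    unfolding det_def by (intro continuous_intros comp)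
  moreover have comp_D: "continuous_on S (\<lambda>s. D s k j $ i $ l)" for k j i l
    by (cases "l = k") (simp_all add: D_def comp)
  have "continuous_on S (\<lambda>s. det (D s k j))" for k j
    unfolding det_def by (intro continuous_on_sum continuous_on_mult continuous_on_const continuous_on_prod comp_D)
  ultimately show ?thesis
    using det by (subst continuous_on_cong[OF refl]) (auto intro!: continuous_intros)
qed

text \<open>The commutation clause comes from the integral formula for \<open>X\<close>; it is what
  later makes any other logarithm commute with \<open>X\<close>.\<close>

lemma principal_log_exists_in_bicommutant:
  fixes A :: "real^'n^'n"
  assumes "invertible A" and neg: "\<And>c. c < 0 \<Longrightarrow> \<not> eigenvalue A c"
  obtains X where "is_principal_log A X" "\<And>M. M ** A = A ** M \<Longrightarrow> M ** X = X ** M"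
proof -
  obtain A' where A': "A' ** A = mat 1" using \<open>invertible A\<close> by (auto simp: invertible_def)
  have nonpos: "\<not> eigenvalue A c" if "c \<le> 0" for c
  proof (cases "c = 0")
    case True
    have "v = 0" if "A *v v = 0" for v
      using A' that by (metis matrix_vector_mul_assoc matrix_vector_mul_lid matrix_vector_mult_0_right)
    then show ?thesis using True by (auto simp: eigenvalue_def)
  qed (use neg that in auto)
  define B where "B t = mat 1 + t *\<^sub>R (A - mat 1)" for t
  \<comment> \<open>A kernel vector of \<open>B t\<close> with \<open>t > 0\<close> would be an
    eigenvector of \<open>A\<close> for (t - 1)/t, which is \<le> 0; \<open>B 0\<close> is the
    identity.\<close>
  have "invertible (B t)" if t: "t \<in> {0..1}" for t
    unfolding invertible_left_inverse matrix_left_invertible_ker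
  proof (intro allI impI, rule ccontr)
    fix v assume v: "B t *v v = 0" "v \<noteq> 0"
    then have eq: "v + t *\<^sub>R (A *v v - v) = 0"
      by (simp add: B_def matrix_vector.add_left matrix_vector.scaleR_left matrix_vector.diff_left)
    with v have "t \<noteq> 0" by auto
    have "t *\<^sub>R (A *v v) = (t - 1) *\<^sub>R v"
      using eq by (simp add: algebra_simps add_eq_0_iff)
    then have "(1 / t) *\<^sub>R t *\<^sub>R (A *v v) = (1 / t) *\<^sub>R (t - 1) *\<^sub>R v"
      by simp
    then have "A *v v = ((t - 1) / t) *\<^sub>R v"
      using \<open>t \<noteq> 0\<close> by simp
    then have "eigenvalue A ((t - 1) / t)"
      using v by (auto simp: eigenvalue_def scalar_mult_eq_scaleR)
    moreover have "(t - 1) / t \<le> 0" using t by (simp add: divide_nonpos_nonneg)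
    ultimately show False using nonpos by blast
  qed
  then have "\<forall>t\<in>{0..1}. \<exists>C. B t ** C = mat 1 \<and> C ** B t = mat 1"
    by (auto simp: invertible_def)
  from bchoice[OF this]
  obtain C where C: "\<And>t. t \<in> {0..1} \<Longrightarrow> B t ** C t = mat 1" "\<And>t. t \<in> {0..1} \<Longrightarrow> C t ** B t = mat 1"
    by blast
  \<comment> \<open>The logarithmic derivative B' B^-1 of the segment from \<open>mat 1\<close> to
    \<open>A\<close>.\<close>
  define Y where "Y t = (A - mat 1) ** C t" for t
  have "continuous_on {0..1} B"
    unfolding B_def by (intro continuous_intros)
  then have "continuous_on {0..1} C"
    using C(1) by (rule continuous_on_right_inverse)
  then have Y_cont: "continuous_on {0..1} Y"
    unfolding Y_def by (intro matrix_mult.continuous_on continuous_intros)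
  have Y_int: "Y integrable_on {0..t}" if "t \<in> {0..1}" for t
    using that by (intro integrable_continuous_real continuous_on_subset[OF Y_cont]) auto
  define X where "X t = integral {0..t} Y" for t
  have X_deriv: "(X has_vector_derivative Y t) (at t within {0..1})" if "t \<in> {0..1}" for t
    unfolding X_def by (rule integral_has_vector_derivative[OF Y_cont that])
  have Y_comm: "M ** Y t = Y t ** M" if M: "M ** A = A ** M" and t: "t \<in> {0..1}" for M t
  proof -
    have MB: "M ** B t = B t ** M"
      by (simp add: B_def matrix_mult.add_left matrix_mult.add_right matrix_mult.scaleR_left matrix_mult.scaleR_right matrix_mult.diff_left matrix_mult.diff_right M)
    have "C t ** M = C t ** (M ** B t) ** C t"
      by (simp add: C[OF t] flip: matrix_mul_assoc)
    also have "\<dots> = M ** C t"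
      unfolding MB by (simp add: C[OF t] matrix_mul_assoc)
    finally have CM: "C t ** M = M ** C t" .
    have "M ** Y t = (M ** (A - mat 1)) ** C t"
      by (simp add: Y_def matrix_mul_assoc)
    also have "M ** (A - mat 1) = (A - mat 1) ** M"
      by (simp add: matrix_mult.diff_left matrix_mult.diff_right M)
    also have "(A - mat 1) ** M ** C t = Y t ** M"
      by (simp add: Y_def CM flip: matrix_mul_assoc)
    finally show ?thesis .
  qed
  have X_comm: "M ** X t = X t ** M" if M: "M ** A = A ** M" and t: "t \<in> {0..1}" for M t
  proof -
    have "M ** X t = integral {0..t} (\<lambda>s. M ** Y s)"
      using integral_linear[OF Y_int[OF t] matrix_mult.bounded_linear_right, of M] by (simp add: X_def o_def)
    also have "\<dots> = integral {0..t} (\<lambda>s. Y s ** M)"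
      using t by (intro integral_cong Y_comm M) auto
    also have "\<dots> = X t ** M"
      using integral_linear[OF Y_int[OF t] matrix_mult.bounded_linear_left, of M] by (simp add: X_def o_def)
    finally show ?thesis .
  qed
  \<comment> \<open>\<open>Y t\<close> commutes with \<open>A\<close>, so it may play the role of
    \<open>M\<close> in \<open>X_comm\<close>.\<close>
  have XY_comm: "Y t ** X t = X t ** Y t" if "t \<in> {0..1}" for t
    using Y_comm[of A t] that by (intro X_comm) simp_all
  \<comment> \<open>The product-rule terms cancel because \<open>Y t\<close> commutes with the
    exponential and \<open>Y t ** B t\<close> is the derivative of \<open>B\<close>.\<close>
  have "((\<lambda>t. matrix_exp (- X t) ** B t) has_vector_derivative 0) (at t within {0..1})"
    if t: "t \<in> {0..1}" for t
  proof -
    have "((\<lambda>s. matrix_exp (- X s)) has_vector_derivative - Y t ** matrix_exp (- X t)) (at t within {0..1})"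
    proof (rule matrix_exp_has_vector_derivative)
      show "((\<lambda>s. - X s) has_vector_derivative - Y s) (at s within {0..1})" if "s \<in> {0..1}" for s
        by (rule has_vector_derivative_minus[OF X_deriv[OF that]])
      have "continuous_on {0..1} X"
        unfolding continuous_on_eq_continuous_within
        using has_vector_derivative_continuous[OF X_deriv] by blast
      then show "bounded ((\<lambda>s. - X s) ` {0..1})" "bounded ((\<lambda>s. - Y s) ` {0..1})"
        using Y_cont by (auto intro!: compact_imp_bounded compact_continuous_image continuous_on_minus)
    qed (use t XY_comm in \<open>auto simp: matrix_mult.minus_left matrix_mult.minus_right\<close>)
    moreover have "(B has_vector_derivative (A - mat 1)) (at t within {0..1})"
      unfolding B_def by (auto intro!: derivative_eq_intros)
    ultimately have "((\<lambda>t. matrix_exp (- X t) ** B t) has_vector_derivative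
        matrix_exp (- X t) ** (A - mat 1) + (- Y t ** matrix_exp (- X t)) ** B t) (at t within {0..1})"
      by (rule matrix_mult.has_vector_derivative)
    moreover have comm: "matrix_exp (- X t) ** Y t = Y t ** matrix_exp (- X t)"
      using XY_comm[OF t] by (intro matrix_exp_commute) (simp add: matrix_mult.minus_left matrix_mult.minus_right)
    have YB: "Y t ** B t = A - mat 1"
      by (simp add: Y_def C[OF t] flip: matrix_mul_assoc)
    have "Y t ** matrix_exp (- X t) ** B t = matrix_exp (- X t) ** (A - mat 1)"
      unfolding YB[symmetric] comm[symmetric] by (simp add: matrix_mul_assoc)
    then have "matrix_exp (- X t) ** (A - mat 1) + (- Y t ** matrix_exp (- X t)) ** B t = 0"
      by (simp add: matrix_mult.minus_left)
    ultimately show ?thesis by simp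
  qed
  then obtain c where "\<And>t. t \<in> {0..1} \<Longrightarrow> matrix_exp (- X t) ** B t = c"
    using has_vector_derivative_zero_constant[of "{0..1}" "\<lambda>t. matrix_exp (- X t) ** B t"] by auto
  \<comment> \<open>Compare the endpoints: \<open>X 0 = 0\<close>, \<open>B 0 = mat 1\<close> and
    \<open>B 1 = A\<close>.\<close>
  from this[of 0] this[of 1] have "matrix_exp (- X 1) ** B 1 = matrix_exp (- X 0) ** B 0"
    by simp
  then have A_inv: "matrix_exp (- X 1) ** A = mat 1"
    by (simp add: B_def X_def)
  have "matrix_exp (- X 1) ** matrix_exp (X 1) = mat 1"
    using matrix_exp_add_cancel[of "X 1" 0] by (simp add: matrix_mult.zero_left matrix_mult.zero_right)
  then have "matrix_exp (X 1) ** matrix_exp (- X 1) = mat 1"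
    by (subst matrix_left_right_inverse)
  then have "matrix_exp (X 1) = A"
    using matrix_mul_assoc[of "matrix_exp (X 1)" "matrix_exp (- X 1)" A] by (simp add: A_inv)
  moreover have "- pi < Im z \<and> Im z < pi" if z: "eigenvalue (cmat (X 1)) z" for z
  proof -
    have "X 1 ** A = A ** X 1" using X_comm[of A 1] by simp
    then obtain v \<mu> where v: "v \<noteq> 0" "cmat (X 1) *v v = z *s v" "cmat A *v v = \<mu> *s v"
      using z by (rule commuting_eigenvector)
    have \<mu>: "\<mu> \<notin> \<real>\<^sub>\<le>\<^sub>0"
    proof
      assume "\<mu> \<in> \<real>\<^sub>\<le>\<^sub>0"
      then obtain c where "\<mu> = of_real c" "c \<le> 0" by (rule nonpos_Reals_cases)
      then show False
        using v nonpos[of c] eigenvalue_cmat_of_real[of A c] by (auto simp: eigenvalue_def)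
    qed
    \<comment> \<open>Eigenvalue of \<open>B t\<close> on \<open>v\<close>. It runs along the
      segment from 1 to \<open>\<mu>\<close>, which avoids the branch cut of \<open>Ln\<close> since
      \<open>\<mu>\<close> does.\<close>
    define g where "g t = 1 + of_real t * (\<mu> - 1)" for t :: real
    have g: "g t \<notin> \<real>\<^sub>\<le>\<^sub>0" if "t \<in> {0..1}" for t
    proof
      assume "g t \<in> \<real>\<^sub>\<le>\<^sub>0"
      then have "1 + t * (Re \<mu> - 1) \<le> 0" "t * Im \<mu> = 0"
        by (simp_all add: complex_nonpos_Reals_iff g_def)
      moreover from this have "t > 0" using that by (cases "t = 0") auto
      moreover have "t * Re \<mu> > 0" if "Re \<mu> > 0" using that \<open>t > 0\<close> by simp
      then have "Re \<mu> \<le> 0"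
        using \<open>1 + t * (Re \<mu> - 1) \<le> 0\<close> \<open>t \<in> {0..1}\<close> by (force simp: algebra_simps not_less[symmetric])
      ultimately have "Im \<mu> = 0" "Re \<mu> \<le> 0" by auto
      then show False using \<mu> by (simp add: complex_nonpos_Reals_iff)
    qed
    have Yv: "cmat (Y t) *v v = ((\<mu> - 1) / g t) *s v" if t: "t \<in> {0..1}" for t
    proof -
      have "g t \<noteq> 0" using g[OF t] by auto
      have "cmat (B t) *v v = g t *s v"
        by (simp add: B_def g_def cmat_add_mult_vec cmat_scaleR_mult_vec cmat_diff_mult_vec cmat_mat_1 v)
          (simp add: vec_eq_iff algebra_simps)
      then have "g t *s (cmat (C t) *v v) = cmat (C t ** B t) *v v"
        by (simp add: cmat_mult vec.scale flip: matrix_vector_mul_assoc)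
      then have "cmat (C t) *v v = (1 / g t) *s v"
        using \<open>g t \<noteq> 0\<close> by (simp add: C[OF t] cmat_mat_1 vec_eq_iff divide_simps mult.commute)
      then show ?thesis
        by (simp add: Y_def cmat_mult vec.scale cmat_diff_mult_vec cmat_mat_1 v flip: matrix_vector_mul_assoc)
          (simp add: vec_eq_iff divide_simps algebra_simps)
    qed
    \<comment> \<open>\<open>Ln \<circ> g\<close> is an antiderivative of the eigenvalue of
      \<open>Y\<close> on \<open>v\<close>; as \<open>g 0 = 1\<close>, the integral is
      \<open>Ln \<mu>\<close>.\<close>
    have "((Ln \<circ> g) has_vector_derivative (\<mu> - 1) * inverse (g t)) (at t within {0..1})"
      if "t \<in> {0..1}" for t
    proof (rule field_vector_diff_chain_within)
      show "(g has_vector_derivative \<mu> - 1) (at t within {0..1})"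
        unfolding g_def by (auto intro!: derivative_eq_intros)
      show "(Ln has_field_derivative inverse (g t)) (at (g t) within g ` {0..1})"
        by (rule has_field_derivative_at_within[OF has_field_derivative_Ln[OF g[OF that]]])
    qed
    then have "((\<lambda>t. (\<mu> - 1) * inverse (g t)) has_integral (Ln \<circ> g) 1 - (Ln \<circ> g) 0) {0..1}"
      by (intro fundamental_theorem_of_calculus zero_le_one)
    then have int: "((\<lambda>t. (\<mu> - 1) / g t) has_integral Ln \<mu>) {0..1}"
      by (simp add: g_def divide_inverse)
    have "bounded_linear (\<lambda>c. c *s v)"
      unfolding linear_conv_bounded_linear[symmetric]
      by (rule linearI) (simp_all add: vec_eq_iff algebra_simps)
    from has_integral_linear[OF int this]
    have "((\<lambda>t. ((\<mu> - 1) / g t) *s v) has_integral Ln \<mu> *s v) {0..1}"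
      by (simp add: o_def)
    \<comment> \<open>Integrating \<open>Y\<close> first and then applying it to \<open>v\<close>
      gives \<open>z *s v\<close>, so \<open>z = Ln \<mu>\<close> lies in the open strip.\<close>
    moreover have "((\<lambda>t. cmat (Y t) *v v) has_integral cmat (X 1) *v v) {0..1}"
      using has_integral_linear[OF integrable_integral[OF Y_int] bounded_linear_cmat_mult_vec, of 1 v]
      by (simp add: o_def X_def)
    then have "((\<lambda>t. ((\<mu> - 1) / g t) *s v) has_integral z *s v) {0..1}"
      by (subst (asm) has_integral_cong[OF Yv]) (simp_all add: v)
    ultimately have "Ln \<mu> *s v = z *s v" by (rule has_integral_unique)
    then have "z = Ln \<mu>" using v(1) by simp
    moreover have "\<mu> \<noteq> 0" using \<mu> by auto
    ultimately show ?thesis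
      using mpi_less_Im_Ln[of \<mu>] Im_Ln_less_pi[OF \<mu>] by simp
  qed
  ultimately have "is_principal_log A (X 1)" by (simp add: is_principal_log_def)
  then show thesis using that[of "X 1"] X_comm[of _ 1] by simp
qed

section \<open>Uniqueness of the principal logarithm\<close>

text \<open>For \<open>D\<close> nonzero, its complex range is a nonzero invariant subspace and
  contains an eigenvector D u, necessarily for 0. Thus D^2 kills \<open>u\<close> while D does
  not.\<close>

lemma matrix_exp_eq_mat_1_no_eigenvalue:
  fixes D :: "real^'n^'n"
  assumes exp: "matrix_exp D = mat 1" and zero: "\<And>d. eigenvalue (cmat D) d \<Longrightarrow> d = 0"
  shows "D = 0"
proof (rule ccontr)
  assume "D \<noteq> 0"
  then obtain x where "D *v x \<noteq> 0" by (auto simp: matrix_eq)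
  then have x: "cmat D *v (\<chi> j. of_real (x $ j)) \<noteq> 0"
    by (simp add: cmat_mult_vec_eq_0_iff)
  have "vec.subspace (range ((*v) (cmat D)))"
    by (intro vec.subspace_image vec.subspace_UNIV)
  from invariant_subspace_eigenvector[OF this _ rangeI x, of "cmat D"]
  obtain v d where v: "v \<in> range ((*v) (cmat D))" "v \<noteq> 0" "cmat D *v v = d *s v"
    by blast
  then have "cmat D *v v = 0" using zero[of d] by (auto simp: eigenvalue_def)
  moreover obtain u where u: "v = cmat D *v u" using v(1) by auto
  ultimately have "cmat (D ** D) *v u = 0"
    by (simp add: cmat_mult matrix_vector_mul_assoc)
  \<comment> \<open>\<open>y\<close> is the real or the imaginary part of \<open>u\<close>: D^2
    kills both, and D does not kill both.\<close>
  with u v(2) obtain y where y: "D *v y \<noteq> 0" "(D ** D) *v y = 0"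
    by (auto simp: cmat_mult_vec_eq_0_iff)
  have high: "matrix_power D (Suc (Suc k)) *v y = 0" for k
  proof -
    have "matrix_power D (Suc (Suc k)) = matrix_power D k ** (D ** D)"
      using matrix_power_commute[of D "D ** D" k] by (simp add: matrix_power_Suc matrix_mul_assoc)
    then show ?thesis using y by (simp flip: matrix_vector_mul_assoc)
  qed
  have "(\<lambda>k. ((1 / fact k) *\<^sub>R matrix_power D k) *v y) sums (matrix_exp D *v y)"
    by (rule bounded_linear.sums[OF matrix_vector.bounded_linear_left matrix_exp_sums])
  moreover have "(\<lambda>k. ((1 / fact k) *\<^sub>R matrix_power D k) *v y) sums (\<Sum>k\<in>{0, Suc 0}. ((1 / fact k) *\<^sub>R matrix_power D k) *v y)"
  proof (rule sums_finite)
    fix k assume "k \<notin> {0, Suc 0}"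
    then obtain j where "k = Suc (Suc j)" by (metis insertCI not0_implies_Suc)
    then show "((1 / fact k) *\<^sub>R matrix_power D k) *v y = 0"
      using high[of j] by (simp add: matrix_vector.scaleR_left)
  qed simp
  ultimately have "matrix_exp D *v y = y + D *v y"
    by (simp add: matrix_power_Suc sums_unique2)
  then show False using y exp by simp
qed

lemma principal_log_unique:
  assumes X: "is_principal_log A X" and Z: "is_principal_log A Z"
    and comm: "\<And>M. M ** A = A ** M \<Longrightarrow> M ** X = X ** M"
  shows "Z = X"
proof -
  have exp: "matrix_exp X = A" "matrix_exp Z = A"
    using X Z by (simp_all add: is_principal_log_def)
  \<comment> \<open>\<open>Z\<close> commutes with its own exponential, which is
    \<open>A\<close>.\<close>
  have ZX: "Z ** X = X ** Z"
    using matrix_exp_commute[of Z Z] by (intro comm) (simp add: exp)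
  define D where "D = X - Z"
  have "matrix_exp X ** matrix_exp (- X) = mat 1"
    using matrix_exp_add_cancel[of "- X" 0] by (simp add: matrix_mult.zero_left matrix_mult.zero_right)
  \<comment> \<open>Both exponentials equal \<open>A\<close>, so
    \<open>matrix_exp Z ** matrix_exp (- X)\<close> is \<open>mat 1\<close> and only the factor
    \<open>matrix_exp (X - Z)\<close> remains.\<close>
  then have "matrix_exp D = mat 1"
    using matrix_exp_add_cancel[of Z "- X"] ZX by (simp add: exp D_def matrix_mult.minus_left matrix_mult.minus_right)
  moreover have "d = 0" if d: "eigenvalue (cmat D) d" for d
  proof -
    have "D ** X = X ** D" by (simp add: D_def matrix_mult.diff_left matrix_mult.diff_right ZX)
    then obtain v c where v: "v \<noteq> 0" "cmat D *v v = d *s v" "cmat X *v v = c *s v"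
      using d by (rule commuting_eigenvector)
    have Zv: "cmat Z *v v = (c - d) *s v"
      using v(2,3) by (simp add: D_def cmat_diff_mult_vec) (simp add: vec_eq_iff algebra_simps)
    have "exp c *s v = exp (c - d) *s v"
      using cmat_exp_eigenvector[OF v(3)] cmat_exp_eigenvector[OF Zv] by (simp add: exp)
    then have "exp c = exp (c - d)" using v(1) by simp
    moreover have "eigenvalue (cmat X) c" "eigenvalue (cmat Z) (c - d)"
      using v Zv by (auto simp: eigenvalue_def)
    then have "- pi < Im c" "Im c < pi" "- pi < Im (c - d)" "Im (c - d) < pi"
      using X Z unfolding is_principal_log_def by blast+
    \<comment> \<open>The complex exponential separates numbers whose imaginary parts differ by less
      than 2 pi.\<close>
    then have "\<bar>Im c - Im (c - d)\<bar> < 2 * pi" by linarith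
    ultimately have "c = c - d" by (rule exp_complex_eqI[rotated])
    then show ?thesis by simp
  qed
  ultimately have "D = 0" by (rule matrix_exp_eq_mat_1_no_eigenvalue)
  then show ?thesis by (simp add: D_def)
qed

section \<open>Conjugation of the principal logarithm\<close>

lemma is_principal_log_conj:
  fixes A P P' :: "real^'n^'n"
  assumes inv: "P ** P' = mat 1" "P' ** P = mat 1" and X: "is_principal_log A X"
  shows "is_principal_log (P ** A ** P') (P ** X ** P')"
  unfolding is_principal_log_def
proof (intro conjI allI impI)
  show "matrix_exp (P ** X ** P') = P ** A ** P'"
    using X by (simp add: matrix_exp_conj inv is_principal_log_def)
  fix z assume "eigenvalue (cmat (P ** X ** P')) z"
  then obtain v where v: "v \<noteq> 0" "cmat (P ** X ** P') *v v = z *s v"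
    by (auto simp: eigenvalue_def)
  let ?w = "cmat P' *v v"
  have "v = cmat (P ** P') *v v" by (simp add: inv cmat_mat_1)
  then have "?w \<noteq> 0"
    using v(1) by (auto simp: cmat_mult simp flip: matrix_vector_mul_assoc)
  have "cmat X *v ?w = cmat (P' ** P ** X ** P') *v v"
    by (simp add: inv cmat_mult matrix_vector_mul_assoc)
  also have "\<dots> = cmat P' *v (cmat (P ** X ** P') *v v)"
    by (simp add: cmat_mult matrix_vector_mul_assoc matrix_mul_assoc)
  also have "\<dots> = z *s ?w"
    by (simp add: v(2) vec.scale)
  finally have "eigenvalue (cmat X) z"
    using \<open>?w \<noteq> 0\<close> by (auto simp: eigenvalue_def)
  then show "- pi < Im z" "Im z < pi"
    using X by (auto simp: is_principal_log_def)
qed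

text \<open>The conjugate of the logarithm of \<open>A\<close> is a candidate for the definite
  description; conjugating any rival back by \<open>P'\<close> reduces its uniqueness to that for
  \<open>A\<close>.\<close>

lemma matrix_log_conj:
  fixes A P P' :: "real^'n^'n"
  assumes inv: "P ** P' = mat 1" "P' ** P = mat 1"
    and A: "invertible A" "\<And>c. c < 0 \<Longrightarrow> \<not> eigenvalue A c"
  shows "matrix_log (P ** A ** P') = P ** matrix_log A ** P'"
proof -
  obtain X where X: "is_principal_log A X" "\<And>M. M ** A = A ** M \<Longrightarrow> M ** X = X ** M"
    using A by (rule principal_log_exists_in_bicommutant) blast+
  have cancel: "P' ** (P ** M ** P') ** P = M" "P ** (P' ** M ** P) ** P' = M" for M :: "real^'n^'n"
  proof -
    have "P' ** (P ** M ** P') ** P = (P' ** P) ** M ** (P' ** P)"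
      "P ** (P' ** M ** P) ** P' = (P ** P') ** M ** (P ** P')"
      by (simp_all add: matrix_mul_assoc)
    then show "P' ** (P ** M ** P') ** P = M" "P ** (P' ** M ** P) ** P' = M"
      by (simp_all add: inv)
  qed
  have "matrix_log A = X"
    unfolding matrix_log_def using X principal_log_unique[OF X(1) _ X(2)] by blast
  moreover have "matrix_log (P ** A ** P') = P ** X ** P'"
    unfolding matrix_log_def
  proof (rule the_equality)
    show "is_principal_log (P ** A ** P') (P ** X ** P')"
      by (rule is_principal_log_conj[OF inv X(1)])
    fix Z assume "is_principal_log (P ** A ** P') Z"
    then have "is_principal_log A (P' ** Z ** P)"
      using is_principal_log_conj[OF inv(2,1)] by (metis cancel(1))
    then have "P' ** Z ** P = X" by (rule principal_log_unique[OF X(1) _ X(2)])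
    then show "Z = P ** X ** P'" by (metis cancel(2))
  qed
  ultimately show ?thesis by simp
qed

section \<open>Conjugation by elements of O(p,q)\<close>

lemma J_mat_square: "J_mat p ** J_mat p = (mat 1 :: real^'n::{finite,linorder}^'n::{finite,linorder})"
proof -
  define \<sigma> :: "'n \<Rightarrow> real" where "\<sigma> i = (if card {k. k < i} < p then - 1 else 1)" for i
  have J: "J_mat p $ i $ j = (if i = j then \<sigma> i else 0)" for i j
    by (simp add: J_mat_def \<sigma>_def)
  have "(\<Sum>k\<in>UNIV. (if i = k then \<sigma> i else 0) * (if k = j then \<sigma> k else 0)) = \<sigma> i * (if i = j then \<sigma> i else 0)" for i j
    by (subst sum.mono_neutral_right[of UNIV "{i}"]) auto
  moreover have "\<sigma> i * \<sigma> i = 1" for i by (simp add: \<sigma>_def)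
  ultimately show ?thesis
    by (simp add: vec_eq_iff mat_def matrix_matrix_mult_def J)
qed

text \<open>Multiply the defining equation of O(p,q) on the right by J and use J J = I.\<close>

lemma O_group_inverse:
  assumes "Q \<in> O_group p"
  shows "Q ** (J_mat p ** transpose Q ** J_mat p) = mat 1"
    "(J_mat p ** transpose Q ** J_mat p) ** Q = mat 1"
proof -
  have "Q ** J_mat p ** transpose Q ** J_mat p = mat 1"
    using assms by (simp add: O_group_def J_mat_square)
  then show "Q ** (J_mat p ** transpose Q ** J_mat p) = mat 1"
    by (simp add: matrix_mul_assoc)
  then show "(J_mat p ** transpose Q ** J_mat p) ** Q = mat 1"
    by (subst matrix_left_right_inverse)
qed

lemma congruence_J_mat:
  "Q ** L ** transpose Q ** J_mat p = Q ** (L ** J_mat p) ** (J_mat p ** transpose Q ** J_mat p)"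
proof -
  have "Q ** (L ** J_mat p) ** (J_mat p ** transpose Q ** J_mat p)
      = Q ** L ** (J_mat p ** J_mat p) ** transpose Q ** J_mat p"
    by (simp add: matrix_mul_assoc)
  then show ?thesis by (simp add: J_mat_square)
qed

text \<open>Logarithm, weighted sum and exponential each respect conjugation by \<open>Q\<close>;
  the trailing factor J turns conjugation back into congruence.\<close>

lemma interpolant_congruence:
  fixes L L' :: "nat \<Rightarrow> real^'n::{finite,linorder}^'n::{finite,linorder}"
  assumes Q: "Q \<in> O_group p"
    and L: "\<And>i. i \<in> {1..m} \<Longrightarrow> L i \<in> L_star p q"
    and L': "\<And>i. i \<in> {1..m} \<Longrightarrow> L' i = Q ** L i ** transpose Q"
  shows "interpolant p m \<phi> L' x = Q ** interpolant p m \<phi> L x ** transpose Q"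
proof -
  define J :: "real^'n::{finite,linorder}^'n::{finite,linorder}" where "J = J_mat p"
  define P where "P = J ** transpose Q ** J"
  have P: "Q ** P = mat 1" "P ** Q = mat 1"
    using O_group_inverse[OF Q] by (simp_all add: P_def J_def)
  have log: "matrix_log (L' i ** J) = Q ** matrix_log (L i ** J) ** P" if i: "i \<in> {1..m}" for i
  proof -
    have "invertible J" using J_mat_square[of p] by (auto simp: invertible_def J_def)
    then have "invertible (L i ** J)"
      using L[OF i] by (auto simp: L_star_def L_set_def intro: invertible_mult)
    moreover have "\<not> eigenvalue (L i ** J) c" if "c < 0" for c
      using L[OF i] that by (simp add: L_star_def J_def)
    ultimately have "matrix_log (Q ** (L i ** J) ** P) = Q ** matrix_log (L i ** J) ** P"
      by (rule matrix_log_conj[OF P])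
    then show ?thesis
      using congruence_J_mat[of Q "L i" p] by (simp add: L'[OF i] P_def J_def)
  qed
  have "(\<Sum>i=1..m. \<phi> i x *\<^sub>R matrix_log (L' i ** J)) = (\<Sum>i=1..m. Q ** (\<phi> i x *\<^sub>R matrix_log (L i ** J)) ** P)"
    by (intro sum.cong) (simp_all add: log matrix_mult.scaleR_left matrix_mult.scaleR_right)
  also have "\<dots> = Q ** (\<Sum>i=1..m. \<phi> i x *\<^sub>R matrix_log (L i ** J)) ** P"
    by (simp only: matrix_mult.sum_left matrix_mult.sum_right)
  finally have "interpolant p m \<phi> L' x = Q ** matrix_exp (\<Sum>i=1..m. \<phi> i x *\<^sub>R matrix_log (L i ** J)) ** P ** J"
    by (simp add: interpolant_def matrix_exp_conj P flip: J_def)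
  \<comment> \<open>The two adjacent factors J cancel, so the inverse of \<open>Q\<close> becomes
    its transpose once it passes J.\<close>
  moreover have "P ** J = J ** transpose Q"
    by (simp add: P_def J_def J_mat_square flip: matrix_mul_assoc)
  then have "M ** P ** J = M ** J ** transpose Q" for M :: "real^'n::{finite,linorder}^'n::{finite,linorder}"
    by (metis matrix_mul_assoc)
  ultimately show ?thesis
    by (simp add: interpolant_def matrix_mul_assoc flip: J_def)
qed

theorem lemma4p1:
  fixes p q m :: nat
    and \<Omega> :: "(real^'d) set"
    and pts :: "nat \<Rightarrow> real^'d"
    and \<phi> :: "nat \<Rightarrow> real^'d \<Rightarrow> real"
    and L :: "nat \<Rightarrow> real^'n::{finite,linorder}^'n::{finite,linorder}"
  assumes "p + q = CARD('n)"
    and "open \<Omega>" and "connected \<Omega>" and "\<Omega> \<noteq> {}"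
    and "\<And>j. j \<in> {1..m} \<Longrightarrow> pts j \<in> \<Omega>"
    and "\<And>i j. i \<in> {1..m} \<Longrightarrow> j \<in> {1..m} \<Longrightarrow> \<phi> i (pts j) = (if i = j then 1 else 0)"
    and "\<And>i. i \<in> {1..m} \<Longrightarrow> L i \<in> L_star p q"
  shows "\<exists>\<epsilon>>0. \<forall>Q\<in>O_group p. \<forall>L'.
           dist Q (mat 1) < \<epsilon> \<longrightarrow>
           (\<forall>i\<in>{1..m}. L' i = Q ** L i ** transpose Q) \<longrightarrow>
           (\<forall>x\<in>\<Omega>. interpolant p m \<phi> L' x = Q ** interpolant p m \<phi> L x ** transpose Q)"
\<comment> \<open>The radius \<open>1\<close> is a convenient witness:
  \<open>interpolant_congruence\<close> gives the identity at each such \<open>Q\<close> and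
  \<open>x\<close>.\<close>
proof (intro exI[of _ 1] conjI ballI allI impI)
  fix Q L' x
  assume "Q \<in> O_group p" "\<forall>i\<in>{1..m}. L' i = Q ** L i ** transpose Q"
  then show "interpolant p m \<phi> L' x = Q ** interpolant p m \<phi> L x ** transpose Q"
    by (intro interpolant_congruence[where q = q] assms(7)) auto
qed simp

end
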